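(* For integers $\nu\ge1$ and $n\ge(\nu+1)^2$, \[ (-1)^\nu\left(\overline{p}(n)+2\sum_{\tau=1}^{\nu}(-1)^\tau\overline{p}(n-\tau^2)\right)=2\,\overline{p}(1,2,\nu;n). \]
   Context: An overpartition of $n$ is a partition of $n$ in which the first occurrence of each distinct part may be overlined; $\overline{p}(n)$ is the number of overpartitions of $n$. Definition of $M(a,m,\nu;n)$ (integers $\nu\ge0$, $1\le a<m$, $n\ge0$): for a partition $\lambda_1\ge\dots\ge\lambda_k$ of $n$ into parts $\equiv a\pmod m$, put $\ell_i=(\lambda_i-a)/m+1$ (number of boxes of the row of $\lambda_i$ in the $m$-modular Young diagram), and let $t$ be the largest integer $0\le t\le k$ with $\ell_t\ge t+\nu+2$ (height of the $(\nu+2)$-Durfee rectangle, of width $t+\nu+2$). $M(a,m,\nu;n)$ counts partitions of $n$ into parts $\equiv a\pmod m$ in which each of $a,a+m,\dots,a+m\nu$ occurs at least once and $\ell_i<t+\nu+2$ for all $i>t$. Definition: $\overline{p}(1,2,\nu;n)$ counts overpartitions of $n$ such that, if $\alpha$ is the sum of all parts other than the non-overlined odd parts, the non-overlined odd parts form a partition counted by $M(1,2,\nu;n-\alpha)$. *)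

theory Defs
  imports "HOL-Library.Multiset" "HOL-Number_Theory.Cong"
begin

definition partitions :: "nat \<Rightarrow> nat multiset set" where
  "partitions n = {P. (\<forall>x \<in># P. 0 < x) \<and> \<Sum>\<^sub># P = n}"

text \<open>An overpartition is a partition together with the set of those part sizes whose
  first occurrence is overlined.\<close>

definition overpartitions :: "nat \<Rightarrow> (nat multiset \<times> nat set) set" where
  "overpartitions n = {(P, S). P \<in> partitions n \<and> S \<subseteq> set_mset P}"

definition overp :: "nat \<Rightarrow> nat" where
  "overp n = card (overpartitions n)"

text \<open>The \<open>i\<close>-th largest part, with multiplicity, for \<open>1 \<le> i \<le> size P\<close>.\<close>

definition nth_part :: "nat multiset \<Rightarrow> nat \<Rightarrow> nat" where
  "nth_part P i = rev (sorted_list_of_multiset P) ! (i - 1)"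

text \<open>The number of boxes in the \<open>i\<close>-th row of the \<open>m\<close>-modular Young diagram; meaningful when all
  parts are congruent to \<open>a\<close> modulo \<open>m\<close> with \<open>1 \<le> a < m\<close>, so that neither the subtraction nor the
  division truncates.\<close>

definition row_length :: "nat \<Rightarrow> nat \<Rightarrow> nat multiset \<Rightarrow> nat \<Rightarrow> nat" where
  "row_length a m P i = (nth_part P i - a) div m + 1"

text \<open>The height of the \<open>(\<nu>+2)\<close>-Durfee rectangle; \<open>t = 0\<close> imposes no condition on the rows.\<close>

definition durfee_height :: "nat \<Rightarrow> nat \<Rightarrow> nat \<Rightarrow> nat multiset \<Rightarrow> nat" where
  "durfee_height a m \<nu> P =
     Max {t. t \<le> size P \<and> (t = 0 \<or> t + \<nu> + 2 \<le> row_length a m P t)}"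

definition M_partitions :: "nat \<Rightarrow> nat \<Rightarrow> nat \<Rightarrow> nat \<Rightarrow> nat multiset set" where
  "M_partitions a m \<nu> n =
     {P \<in> partitions n.
        (\<forall>x \<in># P. [x = a] (mod m)) \<and>
        (\<forall>j \<le> \<nu>. a + m * j \<in># P) \<and>
        (\<forall>i. durfee_height a m \<nu> P < i \<and> i \<le> size P \<longrightarrow>
             row_length a m P i < durfee_height a m \<nu> P + \<nu> + 2)}"

definition nonoverlined_odd_parts :: "nat multiset \<times> nat set \<Rightarrow> nat multiset" where
  "nonoverlined_odd_parts \<pi> = filter_mset odd (fst \<pi> - mset_set (snd \<pi>))"

text \<open>The argument of \<open>M_partitions\<close> is \<open>n - \<alpha>\<close>, where \<open>\<alpha> \<le> n\<close> is the sum of all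
  parts other than the non-overlined odd ones.\<close>

definition overp_1_2 :: "nat \<Rightarrow> nat \<Rightarrow> nat" where
  "overp_1_2 \<nu> n =
     card {\<pi> \<in> overpartitions n.
       nonoverlined_odd_parts \<pi>
         \<in> M_partitions 1 2 \<nu> (n - \<Sum>\<^sub># (fst \<pi> - nonoverlined_odd_parts \<pi>))}"

lemma finite_partitions: "finite (partitions n)"
proof (rule finite_subset)
  show "partitions n \<subseteq> mset ` {xs. set xs \<subseteq> {..n} \<and> length xs \<le> n}"
  proof
    fix P assume L: "P \<in> partitions n"
    obtain xs where xs: "P = mset xs" using ex_mset by metis
    have pos: "\<And>x. x \<in> set xs \<Longrightarrow> 0 < x" and s: "sum_list xs = n"
      using L by (auto simp: partitions_def xs sum_mset_sum_list)
    have "length xs \<le> sum_list xs"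
      using pos by (induction xs) (auto simp: Suc_le_eq add_strict_increasing)
    then show "P \<in> mset ` {xs. set xs \<subseteq> {..n} \<and> length xs \<le> n}"
      using xs s member_le_sum_list[of _ xs] by auto
  qed
  show "finite (mset ` {xs. set xs \<subseteq> {..n} \<and> length xs \<le> n})"
    by (intro finite_imageI finite_lists_length_le) simp
qed

lemma finite_overpartitions: "finite (overpartitions n)"
proof (rule finite_subset)
  show "overpartitions n \<subseteq> (SIGMA P : partitions n. Pow (set_mset P))"
    by (auto simp: overpartitions_def)
qed (auto simp: finite_partitions)

end

theory Submission
  imports Defs "HOL-Computational_Algebra.Formal_Power_Series"
begin

text \<open>
  Say that a partition is \<open>k\<close>-balanced if for some \<open>t\<close> exactly \<open>t\<close> of its odd parts are at least
  \<open>2 t + k\<close>. Removing one copy of each of \<open>1, 3, \<dots>, 2 \<nu> + 1\<close>, of total size \<open>(\<nu> + 1)\<^sup>2\<close>, identifies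
  the overpartitions on the right-hand side with those of \<open>n - (\<nu> + 1)\<^sup>2\<close> whose non-overlined
  parts are \<open>(2 \<nu> + 3)\<close>-balanced. A partition that is not \<open>k\<close>-balanced has, for a unique \<open>t\<close>, a
  \<open>(t + 1)\<close>-st largest odd part equal to \<open>2 t + k\<close>; removing it and adding \<open>2\<close> to each of the \<open>t\<close>
  largest odd parts gives a \<open>(k + 2)\<close>-balanced partition of size smaller by \<open>k\<close>, and this is
  bijective. Hence the right-hand sides for \<open>\<nu>\<close> and \<open>\<nu> + 1\<close> add up to
  \<open>2 overp (n - (\<nu> + 1)\<^sup>2)\<close>. So do the left-hand sides, and the claim follows by descending
  induction on \<open>\<nu>\<close>, the base case being Gauss's identity
  \<open>(\<Prod>i. (1 - q^i) / (1 + q^i)) = 1 + 2 (\<Sum>\<tau>\<ge>1. (-1)^\<tau> q^(\<tau>\<^sup>2))\<close>.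
\<close>

subsection \<open>Gauss's identity for overpartitions\<close>

unbundle fps_syntax

definition gauss_factor :: "nat \<Rightarrow> rat fps" where
  "gauss_factor i = (1 - fps_X ^ i) * inverse (1 + fps_X ^ i)"

lemma inverse_one_plus_X_power:
  "inverse (1 + fps_X ^ i :: rat fps) * (1 + fps_X ^ i) = 1"
  \<comment> \<open>The constant term is 2 for \<open>i = 0\<close> and 1 otherwise, so it is
    invertible over the rationals.\<close>
  by (rule inverse_mult_eq_1) (cases i, auto)

text \<open>With \<open>P\<close> the partial products of the Gauss factors, the terms
  \<open>(-1)^s (2 / (1 + q^s)) q^(s (n + 1)) P n / P s\<close>, \<open>s \<le> n\<close>, sum exactly to the truncated theta series,
  and only the term \<open>s = 0\<close>, which is \<open>P n\<close>, survives modulo \<open>q^(n + 1)\<close>; this is a finite form of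
  Gauss's identity in the style of Shanks. The telescoping certificate for the difference in \<open>n\<close>
  is \<open>shanks_cert\<close>.\<close>

definition shanks_term :: "nat \<Rightarrow> nat \<Rightarrow> rat fps" where
  "shanks_term n s = (-1) ^ s * (2 * inverse (1 + fps_X ^ s)) * fps_X ^ (s * (n + 1)) *
     (\<Prod>i=Suc s..<Suc n. gauss_factor i)"

definition shanks_cert :: "nat \<Rightarrow> nat \<Rightarrow> rat fps" where
  "shanks_cert n s = (-1) ^ s * (2 * inverse (1 + fps_X ^ n)) * fps_X ^ (s * n) *
     (\<Prod>i=s..<n. gauss_factor i)"

text \<open>Factoring out \<open>2 * e * z * W\<close> leaves a rational identity in x = q^s and y =
  q^(n+1) with denominator (1 + x)(1 + y); both numerators are x - x y - 1 - y.\<close>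

lemma shanks_term_diff:
  assumes "s \<le> n"
  shows "shanks_term (Suc n) s - shanks_term n s
       = shanks_cert (Suc n) (Suc s) - shanks_cert (Suc n) s"
proof -
  define W where "W = (\<Prod>i=Suc s..<Suc n. gauss_factor i)"
  define A where "A = inverse (1 + fps_X ^ s :: rat fps)"
  define B where "B = inverse (1 + fps_X ^ Suc n :: rat fps)"
  define x where "x = (fps_X ^ s :: rat fps)"
  define y where "y = (fps_X ^ Suc n :: rat fps)"
  define z where "z = (fps_X ^ (s * Suc n) :: rat fps)"
  define e where "e = ((-1) ^ s :: rat fps)"
  have A: "A * (1 + x) = 1" and B: "B * (1 + y) = 1"
    by (simp_all only: A_def B_def x_def y_def inverse_one_plus_X_power)
  have P1: "(\<Prod>i=Suc s..<Suc (Suc n). gauss_factor i) = W * ((1 - y) * B)"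
    using assms by (simp add: W_def gauss_factor_def y_def B_def)
  have P2: "(\<Prod>i=s..<Suc n. gauss_factor i) = ((1 - x) * A) * W"
    using assms by (subst prod.atLeast_Suc_lessThan) (auto simp: W_def gauss_factor_def x_def A_def)
  have X1: "fps_X ^ (s * (Suc n + 1)) = z * x" and X2: "fps_X ^ (Suc s * Suc n) = z * y"
    by (simp_all add: z_def x_def y_def power_add [symmetric] algebra_simps)
  have "shanks_term (Suc n) s = e * (2 * A) * (z * x) * (W * ((1 - y) * B))"
    unfolding shanks_term_def P1 X1 by (simp add: e_def A_def x_def)
  moreover have "shanks_term n s = e * (2 * A) * z * W"
    by (simp add: shanks_term_def e_def A_def z_def W_def)
  moreover have "shanks_cert (Suc n) (Suc s) = - e * (2 * B) * (z * y) * W"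
    unfolding shanks_cert_def X2 W_def by (simp add: e_def B_def)
  moreover have "shanks_cert (Suc n) s = e * (2 * B) * z * (((1 - x) * A) * W)"
    unfolding shanks_cert_def P2 by (simp add: e_def B_def z_def)
  moreover have "A * x * (1 - y) * B - A = - B * y - B * (1 - x) * A"
    using A B by algebra
  ultimately show ?thesis by algebra
qed

text \<open>Raising \<open>n\<close> by one changes the old summands by a telescoping sum of
  certificates. What remains of it and the new summand \<open>s = n + 1\<close> share the factor 2 /
  (1 + y) with y = q^(n+1); together they carry 1 + y, which cancels the denominator and leaves the
  next theta term.\<close>

lemma shanks_gauss:
  "(\<Sum>s\<le>n. shanks_term n s) = 1 + 2 * (\<Sum>\<tau>=1..n. (-1) ^ \<tau> * fps_X ^ (\<tau>\<^sup>2))"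
proof (induction n)
  case 0
  have "inverse (1 + 1 :: rat fps) * (1 + 1) = 1"
    using inverse_one_plus_X_power [of 0] by simp
  then show ?case by (simp add: shanks_term_def mult.commute)
next
  case (Suc n)
  define y where "y = (fps_X ^ Suc n :: rat fps)"
  define B where "B = inverse (1 + y)"
  have B: "B * (1 + y) = 1" 
    unfolding B_def y_def by (rule inverse_one_plus_X_power)
  have "(\<Sum>s\<le>n. shanks_term (Suc n) s) - (\<Sum>s\<le>n. shanks_term n s)
      = (\<Sum>s<Suc n. shanks_cert (Suc n) (Suc s) - shanks_cert (Suc n) s)"
    by (simp add: sum_subtractf [symmetric] shanks_term_diff lessThan_Suc_atMost del: sum.lessThan_Suc)
  also have "\<dots> = shanks_cert (Suc n) (Suc n) - shanks_cert (Suc n) 0"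
    by (rule sum_lessThan_telescope)
  \<comment> \<open>For \<open>s = 0\<close> the product starts with \<open>gauss_factor 0\<close>,
    whose numerator is 1 - 1.\<close>
  also have "shanks_cert (Suc n) 0 = 0"
    using prod.atLeast_Suc_lessThan [of 0 "Suc n" gauss_factor]
    by (simp add: shanks_cert_def gauss_factor_def [of 0] del: prod.op_ivl_Suc)
  also have "shanks_cert (Suc n) (Suc n) = (-1) ^ Suc n * (2 * B) * fps_X ^ ((Suc n)\<^sup>2)"
    by (simp add: shanks_cert_def B_def y_def power2_eq_square)
  finally have 1: "(\<Sum>s\<le>n. shanks_term (Suc n) s) = (\<Sum>s\<le>n. shanks_term n s)
      + (-1) ^ Suc n * (2 * B) * fps_X ^ ((Suc n)\<^sup>2)"
    by (simp add: algebra_simps)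
  have X: "fps_X ^ (Suc n * (Suc n + 1)) = fps_X ^ ((Suc n)\<^sup>2) * y"
    by (simp add: y_def power_add [symmetric] power2_eq_square algebra_simps)
  have 2: "shanks_term (Suc n) (Suc n) = (-1) ^ Suc n * (2 * B) * (fps_X ^ ((Suc n)\<^sup>2) * y)"
    unfolding shanks_term_def X by (simp add: B_def y_def)
  have "(\<Sum>s\<le>Suc n. shanks_term (Suc n) s) = (\<Sum>s\<le>n. shanks_term n s)
      + (-1) ^ Suc n * (2 * B) * fps_X ^ ((Suc n)\<^sup>2) + (-1) ^ Suc n * (2 * B) * (fps_X ^ ((Suc n)\<^sup>2) * y)"
    unfolding sum.atMost_Suc 1 2 ..
  also have "\<dots> = (\<Sum>s\<le>n. shanks_term n s) + (-1) ^ Suc n * 2 * fps_X ^ ((Suc n)\<^sup>2)"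
  proof -
    have "S + e * (2 * B) * w + e * (2 * B) * (w * y) = S + e * 2 * w" for S e w
      using B by algebra
    then show ?thesis .
  qed
  finally show ?case
    unfolding Suc.IH by (simp add: algebra_simps)
qed

text \<open>Overpartitions split into the multiset \<open>R\<close> of non-overlined parts and the set \<open>S\<close> of
  overlined ones.\<close>

definition overpairs :: "nat set \<Rightarrow> nat set \<Rightarrow> nat \<Rightarrow> (nat multiset \<times> nat set) set" where
  "overpairs A B n =
     {(R, S). set_mset R \<subseteq> A \<and> finite S \<and> S \<subseteq> B \<and> \<Sum>\<^sub># R + \<Sum>S = n}"

lemma sum_mset_mset_set: "\<Sum>\<^sub># (mset_set S) = \<Sum>S" for S :: "nat set"
  by (simp add: sum_unfold_sum_mset)

lemma mset_set_subseteq_iff: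
  "finite S \<Longrightarrow> mset_set S \<subseteq># P \<longleftrightarrow> S \<subseteq> set_mset P"
  by (auto simp: subseteq_mset_def count_mset_set' Suc_le_eq subset_iff)

lemma bij_betw_overpartitions:
  "bij_betw (\<lambda>(P, S). (P - mset_set S, S)) (overpartitions n) (overpairs {0<..} {0<..} n)"
proof (rule bij_betw_byWitness [where f' = "\<lambda>(R, S). (R + mset_set S, S)"])
  have sub: "finite S" "mset_set S \<subseteq># P" if "S \<subseteq> set_mset P" for P and S :: "nat set"
    using that finite_subset mset_set_subseteq_iff by blast+
  show "\<forall>a\<in>overpartitions n. (\<lambda>(R, S). (R + mset_set S, S)) ((\<lambda>(P, S). (P - mset_set S, S)) a) = a"
    using sub by (auto simp: overpartitions_def)
  show "\<forall>a\<in>overpairs {0<..} {0<..} n. (\<lambda>(P, S). (P - mset_set S, S)) ((\<lambda>(R, S). (R + mset_set S, S)) a) = a"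
    by auto
  show "(\<lambda>(P, S). (P - mset_set S, S)) ` overpartitions n \<subseteq> overpairs {0<..} {0<..} n"
  proof clarify
    fix P S assume PS: "(P, S) \<in> overpartitions n"
    then have S: "S \<subseteq> set_mset P" by (simp add: overpartitions_def)
    have "\<Sum>\<^sub># (P - mset_set S) + \<Sum>S = \<Sum>\<^sub># P"
      by (metis sub(2) [OF S] subset_mset.diff_add sum_mset.union sum_mset_mset_set)
    then show "(P - mset_set S, S) \<in> overpairs {0<..} {0<..} n"
      using PS sub [OF S]
      by (auto simp: overpartitions_def partitions_def overpairs_def dest: in_diffD)
  qed
  show "(\<lambda>(R, S). (R + mset_set S, S)) ` overpairs {0<..} {0<..} n \<subseteq> overpartitions n"
    by (auto simp: overpartitions_def partitions_def overpairs_def sum_mset_mset_set)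
qed

lemma overp_eq_card_overpairs: "overp n = card (overpairs {0<..} {0<..} n)"
  unfolding overp_def by (rule bij_betw_same_card [OF bij_betw_overpartitions])

lemma finite_overpairs:
  assumes "A \<subseteq> {0<..}" "B \<subseteq> {0<..}"
  shows "finite (overpairs A B n)"
proof (rule finite_subset)
  show "overpairs A B n \<subseteq> overpairs {0<..} {0<..} n"
    using assms by (auto simp: overpairs_def)
  show "finite (overpairs {0<..} {0<..} n)"
    using bij_betw_overpartitions finite_overpartitions bij_betw_finite by blast
qed

text \<open>Split by whether \<open>a\<close> occurs in \<open>R\<close>. Deleting one copy leaves a
  pair in which \<open>a\<close> may occur again, hence \<open>insert a A\<close> in the last term:
  coefficientwise, this is the factor 1 / (1 - q^a).\<close>

lemma card_overpairs_insert_part: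
  assumes "insert a A \<subseteq> {0<..}" "B \<subseteq> {0<..}" "a \<notin> A"
  shows "card (overpairs (insert a A) B n)
       = card (overpairs A B n) + (if a \<le> n then card (overpairs (insert a A) B (n - a)) else 0)"
proof -
  let ?f = "\<lambda>(R, S). (add_mset a R, S :: nat set)"
  let ?C = "if a \<le> n then ?f ` overpairs (insert a A) B (n - a) else {}"
  have "overpairs (insert a A) B n \<subseteq> overpairs A B n \<union> ?C"
  proof clarify
    fix R S assume RS: "(R, S) \<in> overpairs (insert a A) B n" "(R, S) \<notin> ?C"
    show "(R, S) \<in> overpairs A B n"
    proof (cases "a \<in># R")
      case True
      then obtain R' where R': "R = add_mset a R'" by (metis mset_add)
      then have "(R', S) \<in> overpairs (insert a A) B (n - a)" "a \<le> n"
        using RS(1) by (auto simp: overpairs_def)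
      then show ?thesis using RS(2) R' by (force simp: image_iff)
    next
      case False
      then show ?thesis using RS(1) by (auto simp: overpairs_def)
    qed
  qed
  moreover have "overpairs A B n \<union> ?C \<subseteq> overpairs (insert a A) B n"
    by (auto simp: overpairs_def)
  ultimately have "overpairs (insert a A) B n = overpairs A B n \<union> ?C" by (rule equalityI)
  moreover have "overpairs A B n \<inter> ?C = {}"
  proof -
    have "(add_mset a R, S) \<notin> overpairs A B n" for R S
      using assms(3) by (simp add: overpairs_def)
    then show ?thesis by auto
  qed
  moreover have "card ?C = (if a \<le> n then card (overpairs (insert a A) B (n - a)) else 0)"
    by (auto intro!: card_image simp: inj_on_def)
  moreover have "finite (overpairs A B n)" "finite ?C"
    using assms finite_overpairs by auto
  ultimately show ?thesis by (simp add: card_Un_disjoint)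
qed

text \<open>A size is overlined at most once, so deleting \<open>a\<close> leads to \<open>B\<close>
  itself: this is the factor 1 + q^a.\<close>

lemma card_overpairs_insert_overlined:
  assumes "A \<subseteq> {0<..}" "insert a B \<subseteq> {0<..}" "a \<notin> B"
  shows "card (overpairs A (insert a B) n)
       = card (overpairs A B n) + (if a \<le> n then card (overpairs A B (n - a)) else 0)"
proof -
  let ?f = "\<lambda>(R, S). (R :: nat multiset, insert a S)"
  let ?C = "if a \<le> n then ?f ` overpairs A B (n - a) else {}"
  have "overpairs A (insert a B) n \<subseteq> overpairs A B n \<union> ?C"
  proof clarify
    fix R S assume RS: "(R, S) \<in> overpairs A (insert a B) n" "(R, S) \<notin> ?C"
    show "(R, S) \<in> overpairs A B n"
    proof (cases "a \<in> S")
      case True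
      then obtain S' where S': "S = insert a S'" "a \<notin> S'" by (metis mk_disjoint_insert)
      then have "(R, S') \<in> overpairs A B (n - a)" "a \<le> n"
        using RS(1) by (auto simp: overpairs_def)
      then show ?thesis using RS(2) S' by (force simp: image_iff)
    next
      case False
      then show ?thesis using RS(1) by (auto simp: overpairs_def)
    qed
  qed
  moreover have "overpairs A B n \<union> ?C \<subseteq> overpairs A (insert a B) n"
  proof -
    have "sum (\<lambda>x. x) (insert a S) = a + \<Sum>S" if "finite S" "S \<subseteq> B" for S
      using that assms(3) by (intro sum.insert) auto
    then show ?thesis by (auto simp: overpairs_def)
  qed
  ultimately have "overpairs A (insert a B) n = overpairs A B n \<union> ?C" by (rule equalityI)
  moreover have "overpairs A B n \<inter> ?C = {}"
    using assms(3) by (auto simp: overpairs_def)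
  moreover have "card ?C = (if a \<le> n then card (overpairs A B (n - a)) else 0)"
  proof -
    have "inj_on ?f (overpairs A B m)" for m
    proof (rule inj_onI, clarsimp)
      fix R S S' assume RS: "(R, S) \<in> overpairs A B m" "(R, S') \<in> overpairs A B m"
        and eq: "insert a S = insert a S'"
      have "a \<notin> S" "a \<notin> S'" using RS assms(3) by (auto simp: overpairs_def)
      then show "S = S'" using eq by (simp add: insert_ident)
    qed
    then show ?thesis by (auto intro!: card_image)
  qed
  moreover have "finite (overpairs A B n)" "finite ?C"
    using assms finite_overpairs by auto
  ultimately show ?thesis by (simp add: card_Un_disjoint)
qed

section \<open>The generating function of overpartitions\<close>

definition overpairs_fps :: "nat \<Rightarrow> nat \<Rightarrow> rat fps" where
  "overpairs_fps M N = Abs_fps (\<lambda>n. of_nat (card (overpairs {0<..M} {0<..N} n)))"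

text \<open>The separate bounds for the two kinds of parts let the numerator and the denominator of
  the product grow one factor at a time.\<close>

lemma overpairs_fps_Suc_part:
  "overpairs_fps (Suc M) N * (1 - fps_X ^ Suc M) = overpairs_fps M N"
proof (rule fps_ext)
  fix n
  have ins: "insert (Suc M) {0<..M} = {0<..Suc M}" by auto
  show "(overpairs_fps (Suc M) N * (1 - fps_X ^ Suc M)) $ n = overpairs_fps M N $ n"
    using card_overpairs_insert_part [of "Suc M" "{0<..M}" "{0<..N}" n, unfolded ins]
    by (auto simp add: subset_iff overpairs_fps_def fps_X_power_mult_right_nth right_diff_distrib
        simp del: power_Suc)
qed

lemma overpairs_fps_Suc_overlined:
  "overpairs_fps M (Suc N) = overpairs_fps M N * (1 + fps_X ^ Suc N)"
proof (rule fps_ext)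
  fix n
  have ins: "insert (Suc N) {0<..N} = {0<..Suc N}" by auto
  show "overpairs_fps M (Suc N) $ n = (overpairs_fps M N * (1 + fps_X ^ Suc N)) $ n"
    using card_overpairs_insert_overlined [of "{0<..M}" "Suc N" "{0<..N}" n, unfolded ins]
    by (auto simp add: subset_iff overpairs_fps_def fps_X_power_mult_right_nth distrib_left
        simp del: power_Suc)
qed

text \<open>The series is the product of the (1 + q^i) / (1 - q^i), whose factors are the
  reciprocals of the Gauss factors; the induction raises both bounds together.\<close>

lemma overpairs_fps_mult_gauss_factors:
  "overpairs_fps N N * (\<Prod>i=1..<Suc N. gauss_factor i) = 1"
proof (induction N)
  case 0
  have "overpairs {} {} n = (if n = 0 then {({#}, {})} else {})" for n
    by (auto simp: overpairs_def)
  then show ?case by (auto simp: overpairs_fps_def fps_eq_iff)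
next
  case (Suc N)
  define y where "y = (fps_X ^ Suc N :: rat fps)"
  have "inverse (1 + y) * (1 + y) = 1"
    unfolding y_def by (rule inverse_one_plus_X_power)
  moreover have "overpairs_fps (Suc N) (Suc N) * (1 - y) = overpairs_fps N N * (1 + y)"
    unfolding overpairs_fps_Suc_overlined overpairs_fps_Suc_part [of N N, symmetric]
    by (simp add: y_def mult_ac)
  moreover have "(\<Prod>i=1..<Suc (Suc N). gauss_factor i)
      = (\<Prod>i=1..<Suc N. gauss_factor i) * ((1 - y) * inverse (1 + y))"
    by (simp add: gauss_factor_def y_def)
  ultimately show ?case using Suc.IH by algebra
qed

text \<open>No part exceeds \<open>n\<close>, so the bound \<open>N\<close> excludes
  nothing.\<close>

lemma overpairs_fps_nth: "n \<le> N \<Longrightarrow> overpairs_fps N N $ n = of_nat (overp n)"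
proof -
  assume "n \<le> N"
  have x_le: "x \<le> n" if "(R, S) \<in> overpairs {0<..} {0<..} n" "x \<in># R \<or> x \<in> S" for R S x
    using that member_le_sum [of x S "\<lambda>x. x"] sum_mset.remove [of x R]
    by (fastforce simp: overpairs_def)
  have "overpairs {0<..N} {0<..N} n = overpairs {0<..} {0<..} n"
  proof (intro equalityI subsetI)
    fix p assume p: "p \<in> overpairs {0<..} {0<..} n"
    obtain R S where RS: "p = (R, S)" by fastforce
    have "set_mset R \<subseteq> {..n}" "S \<subseteq> {..n}" using x_le p RS by blast+
    then show "p \<in> overpairs {0<..N} {0<..N} n"
      using p RS \<open>n \<le> N\<close> by (fastforce simp: overpairs_def)
  qed (auto simp: overpairs_def)
  then show ?thesis by (simp add: overpairs_fps_def overp_eq_card_overpairs)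
qed

text \<open>Multiply the finite identity by the overpartition series. The summand
  \<open>s = 0\<close> becomes 1, and those with \<open>s \<ge> 1\<close> are divisible by q^(n+1),
  so the coefficient of q^n vanishes.\<close>

lemma gauss_overpartitions:
  assumes "n > 0"
  shows "int (overp n) + 2 * (\<Sum>\<tau>\<in>{\<tau>. 1 \<le> \<tau> \<and> \<tau>\<^sup>2 \<le> n}. (-1) ^ \<tau> * int (overp (n - \<tau>\<^sup>2))) = 0"
proof -
  let ?O = "overpairs_fps n n"
  define T where "T = (1 + 2 * (\<Sum>\<tau>=1..n. (-1) ^ \<tau> * fps_X ^ (\<tau>\<^sup>2)) :: rat fps)"
  have 0: "shanks_term n 0 = (\<Prod>i=1..<Suc n. gauss_factor i)"
    using inverse_one_plus_X_power [of 0] by (simp add: shanks_term_def mult.commute)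
  have "T = (\<Sum>s\<in>insert 0 {1..n}. shanks_term n s)"
    unfolding T_def shanks_gauss [symmetric] by (rule sum.cong) auto
  then have T: "T = (\<Prod>i=1..<Suc n. gauss_factor i) + (\<Sum>s=1..n. shanks_term n s)"
    using 0 by simp
  have "\<exists>U. shanks_term n s = fps_X ^ Suc n * U" if "s \<in> {1..n}" for s
  proof -
    have "s * (n + 1) = Suc n + (s - 1) * (n + 1)" using that by (cases s) auto
    then have "fps_X ^ (s * (n + 1)) = fps_X ^ Suc n * (fps_X ^ ((s - 1) * (n + 1)) :: rat fps)"
      by (simp add: power_add)
    then have "shanks_term n s = fps_X ^ Suc n * ((-1) ^ s * (2 * inverse (1 + fps_X ^ s)) *
        fps_X ^ ((s - 1) * (n + 1)) * (\<Prod>i=Suc s..<Suc n. gauss_factor i))"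
      unfolding shanks_term_def by (simp only: mult_ac)
    then show ?thesis ..
  qed
  then have "fps_X ^ Suc n dvd (\<Sum>s=1..n. shanks_term n s)"
    by (intro dvd_sum) (auto simp: dvd_def)
  then obtain U where U: "(\<Sum>s=1..n. shanks_term n s) = fps_X ^ Suc n * U" by (auto simp: dvd_def)
  have "?O * T = 1 + fps_X ^ Suc n * (?O * U)"
    unfolding T U distrib_left overpairs_fps_mult_gauss_factors by (simp add: algebra_simps)
  then have "(?O * T) $ n = 0"
    using assms by (simp add: fps_X_power_mult_nth del: power_Suc)
  moreover have "(?O * T) $ n = ?O $ n + 2 * (\<Sum>\<tau>=1..n. (-1) ^ \<tau> * (if n < \<tau>\<^sup>2 then 0 else ?O $ (n - \<tau>\<^sup>2)))"
  proof -
    have "?O * T = ?O + fps_const 2 * (\<Sum>\<tau>=1..n. fps_const ((-1) ^ \<tau>) * (?O * fps_X ^ (\<tau>\<^sup>2)))"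
      by (simp add: T_def distrib_left sum_distrib_left numeral_fps_const fps_const_power [symmetric]
          fps_const_neg [symmetric] mult_ac del: fps_const_power fps_const_neg)
    then show ?thesis
      by (simp add: fps_sum_nth fps_X_power_mult_right_nth)
  qed
  \<comment> \<open>The indices whose square exceeds \<open>n\<close> contribute 0, and the others
    lie in \<open>{1..n}\<close>.\<close>
  moreover have "(\<Sum>\<tau>=1..n. (-1) ^ \<tau> * (if n < \<tau>\<^sup>2 then 0 else ?O $ (n - \<tau>\<^sup>2)))
     = (\<Sum>\<tau>\<in>{\<tau>. 1 \<le> \<tau> \<and> \<tau>\<^sup>2 \<le> n}. (-1) ^ \<tau> * rat_of_nat (overp (n - \<tau>\<^sup>2)))"
  proof (rule sum.mono_neutral_cong_right)
    show "{\<tau>. 1 \<le> \<tau> \<and> \<tau>\<^sup>2 \<le> n} \<subseteq> {1..n}"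
      by (auto simp: power2_nat_le_imp_le)
  qed (auto simp: overpairs_fps_nth)
  ultimately have "rat_of_int (int (overp n) + 2 * (\<Sum>\<tau>\<in>{\<tau>. 1 \<le> \<tau> \<and> \<tau>\<^sup>2 \<le> n}. (-1) ^ \<tau> * int (overp (n - \<tau>\<^sup>2)))) = 0"
    by (simp add: overpairs_fps_nth)
  then show ?thesis by (simp only: of_int_eq_0_iff)
qed

subsection \<open>Balanced partitions\<close>

definition odd_count :: "nat \<Rightarrow> nat multiset \<Rightarrow> nat" where
  "odd_count c R = size {#x \<in># R. odd x \<and> c \<le> x#}"

text \<open>For odd parts and \<open>k = 2 * \<nu> + 3\<close>, the threshold
  \<open>2 * t + k\<close> is the part whose row in the 2-modular diagram has t + \<nu> + 2 boxes.
  Even parts are ignored, so that they need not be split off.\<close>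

definition durfee_balanced :: "nat \<Rightarrow> nat multiset \<Rightarrow> bool" where
  "durfee_balanced k R \<longleftrightarrow> (\<exists>t. odd_count (2 * t + k) R = t)"

lemma odd_count_antimono: "c \<le> d \<Longrightarrow> odd_count d R \<le> odd_count c R"
  unfolding odd_count_def by (intro size_mset_mono) (auto simp: subseteq_mset_def)

text \<open>The count at threshold \<open>2 * t + k\<close> does not increase with \<open>t\<close>,
  so it meets \<open>t\<close> at most once.\<close>

lemma durfee_balanced_unique:
  assumes "odd_count (2 * t + k) R = t" "odd_count (2 * u + k) R = u"
  shows "t = u"
proof -
  have "2 * t + k \<le> 2 * u + k \<or> 2 * u + k \<le> 2 * t + k" by linarith
  then show ?thesis using assms odd_count_antimono [of "2 * t + k" "2 * u + k" R]
      odd_count_antimono [of "2 * u + k" "2 * t + k" R] by linarith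
qed

text \<open>The count minus \<open>t\<close> is strictly decreasing in \<open>t\<close> and
  eventually nonpositive. It avoids 0 exactly if it jumps over 0 between some \<open>t\<close> and
  \<open>t + 1\<close>; the threshold at \<open>t + 1\<close> is
  \<open>2 * t + k + 2\<close>.\<close>

lemma not_durfee_balanced_iff:
  "\<not> durfee_balanced k R
     \<longleftrightarrow> (\<exists>t. t < odd_count (2 * t + k) R \<and> odd_count (2 * t + k + 2) R \<le> t)"
proof
  assume L: "\<not> durfee_balanced k R"
  have ex: "odd_count (2 * size R + k) R \<le> size R"
    unfolding odd_count_def by (rule size_filter_mset_lesseq)
  define u where "u = (LEAST u. odd_count (2 * u + k) R \<le> u)"
  have u: "odd_count (2 * u + k) R \<le> u"
    unfolding u_def by (rule LeastI, rule ex)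
  then have "odd_count (2 * u + k) R < u"
    using L by (auto simp: durfee_balanced_def order_le_less)
  then obtain t where t: "u = Suc t" by (cases u) auto
  then have "\<not> odd_count (2 * t + k) R \<le> t"
    using not_less_Least [of t "\<lambda>u. odd_count (2 * u + k) R \<le> u"] u_def by simp
  then show "\<exists>t. t < odd_count (2 * t + k) R \<and> odd_count (2 * t + k + 2) R \<le> t"
    using \<open>odd_count (2 * u + k) R < u\<close> t by (intro exI [of _ t]) (auto simp: add_ac)
next
  assume "\<exists>t. t < odd_count (2 * t + k) R \<and> odd_count (2 * t + k + 2) R \<le> t"
  then obtain t where t: "t < odd_count (2 * t + k) R" "odd_count (2 * t + k + 2) R \<le> t" by blast
  have "odd_count (2 * u + k) R \<noteq> u" for u
  proof (cases "u \<le> t")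
    case True
    then show ?thesis using t(1) odd_count_antimono [of "2 * u + k" "2 * t + k" R] by auto
  next
    case False
    then show ?thesis using t(2) odd_count_antimono [of "2 * t + k + 2" "2 * u + k" R] by auto
  qed
  then show "\<not> durfee_balanced k R" by (auto simp: durfee_balanced_def)
qed

text \<open>The inverse of the bijection: lower the \<open>t\<close> largest odd parts by \<open>2\<close> and insert the part
  \<open>2 t + k\<close>. In this direction no choice among equal parts arises.\<close>

definition insert_row :: "nat \<Rightarrow> nat \<Rightarrow> nat multiset \<Rightarrow> nat multiset" where
  "insert_row k t R = {#x \<in># R. \<not> (odd x \<and> 2 * t + k + 2 \<le> x)#}
     + {#2 * t + k#} + image_mset (\<lambda>x. x - 2) {#x \<in># R. odd x \<and> 2 * t + k + 2 \<le> x#}"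

text \<open>The new part contributes 2 t + k, and \<open>t\<close> parts lose 2 each.\<close>

lemma sum_mset_insert_row:
  assumes "odd_count (2 * t + k + 2) R = t"
  shows "\<Sum>\<^sub># (insert_row k t R) = \<Sum>\<^sub># R + k"
proof -
  let ?H = "{#x \<in># R. odd x \<and> 2 * t + k + 2 \<le> x#}"
  have "\<Sum>\<^sub># (image_mset (\<lambda>x. x - 2) H) + 2 * size H = \<Sum>\<^sub># H"
    if "\<forall>x\<in>#H. 2 \<le> x" for H :: "nat multiset"
    using that by (induction H) auto
  from this [of ?H] have "\<Sum>\<^sub># (image_mset (\<lambda>x. x - 2) ?H) + 2 * t = \<Sum>\<^sub># ?H"
    using assms by (auto simp: odd_count_def)
  moreover have "\<Sum>\<^sub># R = \<Sum>\<^sub># ?H + \<Sum>\<^sub># {#x \<in># R. \<not> (odd x \<and> 2 * t + k + 2 \<le> x)#}"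
    by (metis multiset_partition sum_mset.union)
  ultimately show ?thesis unfolding insert_row_def by simp
qed

text \<open>The \<open>t\<close> lowered parts and the new one are odd and at least 2 t + k, and
  only lowered parts can still reach 2 t + k + 2. Hence the image is not
  \<open>k\<close>-balanced.\<close>

lemma odd_count_insert_row:
  assumes "odd k" "odd_count (2 * t + k + 2) R = t"
  shows "t < odd_count (2 * t + k) (insert_row k t R)"
    and "odd_count (2 * t + k + 2) (insert_row k t R) \<le> t"
proof -
  let ?H = "{#x \<in># R. odd x \<and> 2 * t + k + 2 \<le> x#}"
  let ?H' = "image_mset (\<lambda>x. x - 2) ?H"
  have H: "size ?H = t" using assms(2) by (simp add: odd_count_def)
  have "{#x \<in># ?H'. odd x \<and> 2 * t + k \<le> x#} = ?H'"
    by (auto simp: filter_mset_eq_conv)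
  then show "t < odd_count (2 * t + k) (insert_row k t R)"
    using H assms(1) by (simp add: odd_count_def insert_row_def)
  have "size {#x \<in># ?H'. odd x \<and> 2 * t + k + 2 \<le> x#} \<le> size ?H'"
    by (rule size_filter_mset_lesseq)
  moreover have "{#x \<in># {#x \<in># R. \<not> (odd x \<and> 2 * t + k + 2 \<le> x)#}. odd x \<and> 2 * t + k + 2 \<le> x#} = {#}"
    by (auto)
  ultimately show "odd_count (2 * t + k + 2) (insert_row k t R) \<le> t"
    using H by (simp add: odd_count_def insert_row_def del: filter_mset_eq_mempty_iff)
qed

text \<open>The odd entries above \<open>c\<close> all come from \<open>H\<close>, so the sum
  determines \<open>H\<close> except for its copies of \<open>c\<close>; their number follows from
  the size. This matters since a lowered part may coincide with an unchanged part 2 t + k.\<close>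

lemma threshold_split_unique:
  fixes L1 L2 H1 H2 :: "nat multiset"
  assumes "L1 + H1 = L2 + H2" "size H1 = size H2"
    and "\<And>x. x \<in># L1 \<Longrightarrow> odd x \<Longrightarrow> x \<le> c" "\<And>x. x \<in># L2 \<Longrightarrow> odd x \<Longrightarrow> x \<le> c"
    and "\<And>x. x \<in># H1 \<Longrightarrow> odd x \<and> c \<le> x" "\<And>x. x \<in># H2 \<Longrightarrow> odd x \<and> c \<le> x"
  shows "L1 = L2 \<and> H1 = H2"
proof -
  have top: "{#x \<in># L + H. odd x \<and> c < x#} = {#x \<in># H. x \<noteq> c#}"
    if "\<And>x. x \<in># L \<Longrightarrow> odd x \<Longrightarrow> x \<le> c" "\<And>x. x \<in># H \<Longrightarrow> odd x \<and> c \<le> x" for L H :: "nat multiset"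
  proof -
    have "{#x \<in># L. odd x \<and> c < x#} = {#}"
      using that(1) by (fastforce)
    moreover have "{#x \<in># H. odd x \<and> c < x#} = {#x \<in># H. x \<noteq> c#}"
      using that(2) by (intro filter_mset_cong) (auto simp: order_less_le)
    ultimately show ?thesis by simp
  qed
  have dec: "H = {#x \<in># H. x \<noteq> c#} + replicate_mset (size H - size {#x \<in># H. x \<noteq> c#}) c" for H :: "nat multiset"
  proof -
    have p: "H = {#x \<in># H. x \<noteq> c#} + {#x \<in># H. x = c#}"
      using multiset_partition [of H "\<lambda>x. x \<noteq> c"] by simp
    then have "size H = size {#x \<in># H. x \<noteq> c#} + count H c"
      by (metis filter_eq_replicate_mset size_replicate_mset size_union)
    then show ?thesis using p by (simp add: filter_eq_replicate_mset)
  qed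
  have "{#x \<in># H1. x \<noteq> c#} = {#x \<in># H2. x \<noteq> c#}"
    using top [of L1 H1] top [of L2 H2] assms by simp
  then have "H1 = H2" using dec [of H1] dec [of H2] assms(2) by simp
  then show ?thesis using assms(1) by simp
qed

lemma insert_row_inj:
  assumes "odd k" "odd_count (2 * t + k + 2) R = t" "odd_count (2 * u + k + 2) Q = u"
    and eq: "insert_row k t R = insert_row k u Q"
  shows "R = Q"
proof -
  \<comment> \<open>If t < u, then 2 t + k + 2 is at most 2 u + k, so monotonicity gives more than u
    odd parts of the image above a threshold that at most t of them reach.\<close>
  have "\<not> t < u" 
    using odd_count_insert_row [OF assms(1,2)] odd_count_insert_row [OF assms(1,3)] eq
      odd_count_antimono [of "2 * t + k + 2" "2 * u + k" "insert_row k u Q"] by fastforce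
  moreover have "\<not> u < t" 
    using odd_count_insert_row [OF assms(1,2)] odd_count_insert_row [OF assms(1,3)] eq
      odd_count_antimono [of "2 * u + k + 2" "2 * t + k" "insert_row k u Q"] by fastforce
  ultimately have tu: "u = t" by simp
  define H where "H R = {#x \<in># R. odd x \<and> 2 * t + k + 2 \<le> x#}" for R
  define L where "L R = {#x \<in># R. \<not> (odd x \<and> 2 * t + k + 2 \<le> x)#}" for R
  define H' where "H' R = image_mset (\<lambda>x. x - 2) (H R)" for R
  have R: "R = L R + H R" for R
    unfolding L_def H_def by (subst multiset_partition [of R "\<lambda>x. odd x \<and> 2 * t + k + 2 \<le> x"]) simp
  \<comment> \<open>As \<open>k\<close> is odd, the only candidate in between, 2 t + k + 1, is
    even.\<close>
  have odd_le: "x \<le> 2 * t + k" if "odd x" "x < 2 * t + k + 2" for x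
    using that assms(1) by presburger
  have HH': "image_mset (\<lambda>x. x + 2) (H' R) = H R" for R
  proof -
    have "image_mset (\<lambda>x. x + 2) (H' R) = image_mset (\<lambda>x. x) (H R)"
      unfolding H'_def image_mset.compositionality comp_def
      by (rule image_mset_cong) (auto simp: H_def)
    then show ?thesis by simp
  qed
  have "L R + H' R = L Q + H' Q"
    using eq by (simp add: insert_row_def tu L_def H'_def H_def)
  moreover have "size (H' R) = size (H' Q)"
    using assms(2,3) by (simp add: tu H'_def H_def odd_count_def)
  ultimately have "L R = L Q \<and> H' R = H' Q"
    by (rule threshold_split_unique [where c = "2 * t + k"])
      (auto simp: L_def H'_def H_def not_le dest: odd_le)
  then show ?thesis using R [of R] R [of Q] HH' by metis
qed

text \<open>With c = 2 t + k, drop one copy of \<open>c\<close> and raise the \<open>t\<close>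
  largest odd parts by 2: these are all of \<open>Hi\<close> and \<open>t - a\<close> copies of
  \<open>c\<close>. The other copies of \<open>c\<close> stay.\<close>

lemma insert_row_surj:
  assumes "odd k" and R: "\<forall>x\<in>#R. 0 < x"
    and hi: "t < odd_count (2 * t + k) R" and lo: "odd_count (2 * t + k + 2) R \<le> t"
  obtains Q where "odd_count (2 * t + k + 2) Q = t" "insert_row k t Q = R" "\<forall>x\<in>#Q. 0 < x"
proof -
  define c where "c = 2 * t + k"
  have c: "odd c" "c > 0" using assms(1) by (auto simp: c_def odd_pos)
  define Hi where "Hi = {#x \<in># R. odd x \<and> c + 2 \<le> x#}"
  define Lo where "Lo = {#x \<in># R. \<not> (odd x \<and> c \<le> x)#}"
  define a where "a = size Hi"
  define m where "m = count R c"
  have odd_ge: "odd x \<and> c \<le> x \<longleftrightarrow> x = c \<or> odd x \<and> c + 2 \<le> x" for x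
    using c(1) by presburger
  have top: "{#x \<in># R. odd x \<and> c \<le> x#} = replicate_mset m c + Hi"
  proof -
    have "{#x \<in># R. odd x \<and> c \<le> x#} = {#x \<in># R. x = c \<or> odd x \<and> c + 2 \<le> x#}"
      by (simp only: odd_ge)
    also have "\<dots> = {#x \<in># R. x = c#} + {#x \<in># R. odd x \<and> c + 2 \<le> x#}"
      by (rule multiset_eqI) auto
    finally show ?thesis by (simp add: filter_eq_replicate_mset m_def Hi_def)
  qed
  have Req: "R = Lo + replicate_mset m c + Hi"
    using multiset_partition [of R "\<lambda>x. odd x \<and> c \<le> x"] top by (simp add: Lo_def add_ac)
  \<comment> \<open>These bounds make the differences \<open>t - a\<close> and
    \<open>m + a - t - 1\<close> below exact.\<close>
  have am: "t < m + a" "a \<le> t"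
    using hi lo unfolding odd_count_def c_def [symmetric] top Hi_def [symmetric] a_def by simp_all
  define K where "K = replicate_mset (t - a) (c + 2) + image_mset (\<lambda>x. x + 2) Hi"
  define L where "L = Lo + replicate_mset (m + a - t - 1) c"
  have K: "\<forall>x\<in>#K. odd x \<and> c + 2 \<le> x" using c by (auto simp: K_def Hi_def)
  have L: "\<forall>x\<in>#L. \<not> (odd x \<and> c + 2 \<le> x)" by (auto simp: L_def Lo_def)
  have fK: "{#x \<in># L + K. odd x \<and> c + 2 \<le> x#} = K" and fL: "{#x \<in># L + K. \<not> (odd x \<and> c + 2 \<le> x)#} = L"
  proof -
    have "{#x \<in># K. odd x \<and> c + 2 \<le> x#} = K" "{#x \<in># L. \<not> (odd x \<and> c + 2 \<le> x)#} = L"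
      using K L by (simp_all add: filter_mset_eq_conv)
    moreover have "{#x \<in># L. odd x \<and> c + 2 \<le> x#} = {#}" "{#x \<in># K. \<not> (odd x \<and> c + 2 \<le> x)#} = {#}"
      using K L by simp_all
    ultimately show "{#x \<in># L + K. odd x \<and> c + 2 \<le> x#} = K" "{#x \<in># L + K. \<not> (odd x \<and> c + 2 \<le> x)#} = L"
      by (simp_all only: filter_union_mset add_0_left add_0_right)
  qed
  show ?thesis
  proof
    show "odd_count (2 * t + k + 2) (L + K) = t"
      unfolding odd_count_def c_def [symmetric] fK using am by (simp add: K_def a_def)
    have "image_mset (\<lambda>x. x - 2) K = replicate_mset (t - a) c + Hi"
      by (simp add: K_def image_mset.compositionality comp_def)
    then have "insert_row k t (L + K) = Lo + (replicate_mset (m + a - t - 1) c + {#c#} + replicate_mset (t - a) c) + Hi"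
      unfolding insert_row_def c_def [symmetric] fK fL by (simp add: L_def)
    also have "replicate_mset (m + a - t - 1) c + {#c#} + replicate_mset (t - a) c = replicate_mset m c"
      using am by (auto intro!: multiset_eqI)
    finally show "insert_row k t (L + K) = R" using Req by simp
    show "\<forall>x\<in>#L + K. 0 < x" using c R by (auto simp: L_def K_def Lo_def)
  qed
qed

section \<open>The recurrence from threshold k to k + 2\<close>

definition balanced_overpairs :: "nat \<Rightarrow> nat \<Rightarrow> (nat multiset \<times> nat set) set" where
  "balanced_overpairs k n = {(R, S) \<in> overpairs {0<..} {0<..} n. durfee_balanced k R}"

text \<open>The second summand counts the pairs of size \<open>n\<close> that are not
  \<open>k\<close>-balanced: \<open>insert_row\<close> acts on the non-overlined parts and leaves
  \<open>S\<close> alone.\<close>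

lemma balanced_overpairs_recurrence:
  assumes "odd k"
  shows "card (balanced_overpairs k n)
       + (if k \<le> n then card (balanced_overpairs (k + 2) (n - k)) else 0) = overp n"
proof -
  let ?U = "{(R, S) \<in> overpairs {0<..} {0<..} n. \<not> durfee_balanced k R}"
  \<comment> \<open>The index \<open>t\<close> depends on \<open>R\<close> but is unique by
    \<open>durfee_balanced_unique\<close> for \<open>k + 2\<close>, so \<open>THE\<close> recovers
    it.\<close>
  let ?f = "\<lambda>(R, S). (insert_row k (THE t. odd_count (2 * t + k + 2) R = t) R, S :: nat set)"
  have bal: "durfee_balanced (k + 2) R \<longleftrightarrow> (\<exists>t. odd_count (2 * t + k + 2) R = t)" for R
    by (simp add: durfee_balanced_def add.assoc)
  have the: "(THE t. odd_count (2 * t + k + 2) R = t) = t" if "odd_count (2 * t + k + 2) R = t" for R t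
    using that durfee_balanced_unique [of _ "k + 2" R] by (intro the_equality) (auto simp: add.assoc)
  have pos: "\<forall>x\<in>#insert_row k t R. 0 < x" if "\<forall>x\<in>#R. 0 < x" for t R
    using that odd_pos [OF assms] by (auto simp: insert_row_def)
  have "card ?U = (if k \<le> n then card (balanced_overpairs (k + 2) (n - k)) else 0)"
  proof (cases "k \<le> n")
    case True
    have "bij_betw ?f (balanced_overpairs (k + 2) (n - k)) ?U"
      unfolding bij_betw_def
    proof
      show "inj_on ?f (balanced_overpairs (k + 2) (n - k))"
      proof (rule inj_onI)
        fix p q assume pq: "p \<in> balanced_overpairs (k + 2) (n - k)" "q \<in> balanced_overpairs (k + 2) (n - k)"
          and eq: "?f p = ?f q"
        obtain R S Q U where RQ: "p = (R, S)" "q = (Q, U)" by (metis surj_pair)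
        obtain t u where tu: "odd_count (2 * t + k + 2) R = t" "odd_count (2 * u + k + 2) Q = u"
          using pq unfolding RQ balanced_overpairs_def mem_Collect_eq prod.case bal by blast
        have "insert_row k t R = insert_row k u Q" "S = U"
          using eq by (simp_all only: RQ prod.case the [OF tu(1)] the [OF tu(2)] prod.inject)
        then show "p = q" using insert_row_inj [OF assms tu] RQ by simp
      qed
      show "?f ` balanced_overpairs (k + 2) (n - k) = ?U"
      proof (intro equalityI subsetI)
        fix p assume "p \<in> ?f ` balanced_overpairs (k + 2) (n - k)"
        then obtain R S t where RS: "(R, S) \<in> overpairs {0<..} {0<..} (n - k)"
            and t: "odd_count (2 * t + k + 2) R = t" and p: "p = (insert_row k t R, S)"
          unfolding balanced_overpairs_def bal using the by fastforce
        have "\<not> durfee_balanced k (insert_row k t R)"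
          using not_durfee_balanced_iff odd_count_insert_row [OF assms t] by blast
        then show "p \<in> ?U"
          using p RS pos [of R t] True sum_mset_insert_row [OF t] by (auto simp: overpairs_def)
      next
        fix p assume "p \<in> ?U"
        then obtain R S where RS: "(R, S) \<in> overpairs {0<..} {0<..} n"
            and R: "\<not> durfee_balanced k R" and p: "p = (R, S)"
          by auto
        obtain t where "t < odd_count (2 * t + k) R" "odd_count (2 * t + k + 2) R \<le> t"
          using R not_durfee_balanced_iff by blast
        moreover have "\<forall>x\<in>#R. 0 < x" using RS by (auto simp: overpairs_def)
        ultimately obtain Q where Q: "odd_count (2 * t + k + 2) Q = t" "insert_row k t Q = R" "\<forall>x\<in>#Q. 0 < x"
          using insert_row_surj [OF assms] by metis
        have "(Q, S) \<in> balanced_overpairs (k + 2) (n - k)"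
          using RS Q sum_mset_insert_row [OF Q(1)] bal [of Q]
          by (auto simp: overpairs_def balanced_overpairs_def)
        moreover have "p = ?f (Q, S)" by (simp only: p prod.case the [OF Q(1)] Q(2))
        ultimately show "p \<in> ?f ` balanced_overpairs (k + 2) (n - k)" by blast
      qed
    qed
    then show ?thesis using True by (simp add: bij_betw_same_card)
  next
    case False
    \<comment> \<open>A partition that is not \<open>k\<close>-balanced has a part of size at least
      2 t + k, hence size at least \<open>k\<close>.\<close>
    have "k \<le> n" if RS: "(R, S) \<in> overpairs {0<..} {0<..} n" and R: "\<not> durfee_balanced k R" for R S
    proof -
      obtain t where t: "t < odd_count (2 * t + k) R"
        using R not_durfee_balanced_iff by blast
      then have "{#x \<in># R. odd x \<and> 2 * t + k \<le> x#} \<noteq> {#}"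
        by (metis odd_count_def not_less_zero size_empty)
      then obtain x where "x \<in># R" "k \<le> x" by (fastforce)
      then show ?thesis using RS sum_mset.remove [of x R] by (auto simp: overpairs_def)
    qed
    then have "?U = {}" using False by auto
    then show ?thesis using False by (metis card.empty)
  qed
  moreover have "card (balanced_overpairs k n \<union> ?U) = card (balanced_overpairs k n) + card ?U"
  proof (rule card_Un_disjoint)
    show "finite (balanced_overpairs k n)" "finite ?U"
      using finite_overpairs [of "{0<..}" "{0<..}" n] by (auto simp: balanced_overpairs_def intro: finite_subset)
    show "balanced_overpairs k n \<inter> ?U = {}" by (auto simp: balanced_overpairs_def)
  qed
  moreover have "balanced_overpairs k n \<union> ?U = overpairs {0<..} {0<..} n"
    by (auto simp: balanced_overpairs_def)
  ultimately show ?thesis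
    unfolding overp_eq_card_overpairs by argo
qed

subsection \<open>Durfee rectangles\<close>

text \<open>In decreasing order the parts that are at least \<open>c\<close> form an initial
  segment, and \<open>t\<close> is its length. This translates counts into conditions on single
  rows.\<close>

lemma size_filter_eq_iff_sorted_desc:
  fixes P :: "nat multiset"
  shows "size {#x \<in># P. c \<le> x#} = t
     \<longleftrightarrow> t \<le> size P \<and> (t = 0 \<or> c \<le> nth_part P t) \<and> (\<forall>i. t < i \<and> i \<le> size P \<longrightarrow> nth_part P i < c)"
proof -
  define xs where "xs = rev (sorted_list_of_multiset P)"
  have P: "P = mset xs" by (simp add: xs_def)
  have desc: "xs ! j \<le> xs ! i" if "i \<le> j" "j < length xs" for i j
    using that unfolding xs_def by (intro sorted_rev_nth_mono) auto
  have nth: "nth_part P i = xs ! (i - 1)" for i by (simp add: nth_part_def xs_def)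
  have size: "size {#x \<in># P. c \<le> x#} = card {i. i < length xs \<and> c \<le> xs ! i}"
    by (simp add: P flip: length_filter_conv_card mset_filter)
  show ?thesis
  proof
    assume R: "t \<le> size P \<and> (t = 0 \<or> c \<le> nth_part P t) \<and> (\<forall>i. t < i \<and> i \<le> size P \<longrightarrow> nth_part P i < c)"
    have "{i. i < length xs \<and> c \<le> xs ! i} = {..<t}"
    proof (intro equalityI subsetI)
      fix i assume "i \<in> {i. i < length xs \<and> c \<le> xs ! i}"
      moreover have "xs ! i < c" if "t \<le> i" "i < length xs"
        using R [THEN conjunct2, THEN conjunct2, rule_format, of "Suc i"] that nth [of "Suc i"] P by simp
      ultimately show "i \<in> {..<t}" by (force simp: not_le [symmetric])
    next
      fix i assume "i \<in> {..<t}"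
      then show "i \<in> {i. i < length xs \<and> c \<le> xs ! i}"
        using R desc [of i "t - 1"] nth [of t] P order_trans by fastforce
    qed
    then show "size {#x \<in># P. c \<le> x#} = t" by (simp add: size)
  next
    assume L: "size {#x \<in># P. c \<le> x#} = t"
    let ?I = "{i. i < length xs \<and> c \<le> xs ! i}"
    have dc: "i \<in> ?I" if "j \<in> ?I" "i \<le> j" for i j using that desc [of i j] by auto
    have card: "card ?I = t" using L size by simp
    have fin: "finite ?I" by simp
    \<comment> \<open>A downward closed set of \<open>t\<close> indices is an initial
      segment.\<close>
    have I: "?I = {..<t}"
    proof -
      have "i < t" if "i \<in> ?I" for i
      proof -
        have "{..i} \<subseteq> ?I" using dc [OF that] by blast
        then have "card {..i} \<le> card ?I" by (intro card_mono fin)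
        then show ?thesis using card by simp
      qed
      then have "?I \<subseteq> {..<t}" by blast
      then show ?thesis using card by (intro card_subset_eq) auto
    qed
    have "t \<le> size P" using L size_filter_mset_lesseq by metis
    moreover have "c \<le> nth_part P t" if "t \<noteq> 0"
    proof -
      have "t - 1 \<in> ?I" using I that by simp
      then show ?thesis by (simp add: nth)
    qed
    moreover have "nth_part P i < c" if "t < i" "i \<le> size P" for i
    proof -
      have "i - 1 \<notin> ?I" unfolding I using that by simp
      then show ?thesis using that nth [of i] P by auto
    qed
    ultimately show "t \<le> size P \<and> (t = 0 \<or> c \<le> nth_part P t) \<and> (\<forall>i. t < i \<and> i \<le> size P \<longrightarrow> nth_part P i < c)"
      by blast
  qed
qed

text \<open>A \<open>t\<close> witnessing balance is one in \<open>?D\<close> beyond which all rows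
  have fewer than t + \<nu> + 2 boxes. No larger index can then lie in \<open>?D\<close>, so
  \<open>t\<close> is the Durfee height.\<close>

lemma durfee_height_rows_iff:
  assumes "\<forall>x\<in>#P. odd x"
  shows "(\<forall>i. durfee_height 1 2 \<nu> P < i \<and> i \<le> size P \<longrightarrow> row_length 1 2 P i < durfee_height 1 2 \<nu> P + \<nu> + 2)
     \<longleftrightarrow> durfee_balanced (2 * \<nu> + 3) P"
proof -
  let ?D = "{t. t \<le> size P \<and> (t = 0 \<or> t + \<nu> + 2 \<le> row_length 1 2 P t)}"
  let ?h = "durfee_height 1 2 \<nu> P"
  have cnt: "odd_count c P = size {#x \<in># P. c \<le> x#}" for c
    unfolding odd_count_def using assms by (metis (no_types, lifting) filter_mset_cong)
  \<comment> \<open>Used with c = t + \<nu>, where 2 c + 3 is the threshold 2 t + (2 \<nu> +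
    3).\<close>
  have row: "c + 2 \<le> row_length 1 2 P i \<longleftrightarrow> 2 * c + 3 \<le> nth_part P i" if "0 < i" "i \<le> size P" for c i
  proof -
    have "length (sorted_list_of_multiset P) = size P"
      by (metis mset_sorted_list_of_multiset size_mset)
    then have "rev (sorted_list_of_multiset P) ! (i - 1) \<in> set (rev (sorted_list_of_multiset P))"
      using that by (intro nth_mem) auto
    then have "nth_part P i \<in># P" by (simp add: nth_part_def)
    then have "odd (nth_part P i)" using assms by blast
    then show ?thesis unfolding row_length_def by presburger
  qed
  have fin: "finite ?D" by (rule finite_subset [of _ "{..size P}"]) auto
  have bal: "odd_count (2 * t + (2 * \<nu> + 3)) P = t \<longleftrightarrow>
      t \<in> ?D \<and> (\<forall>i. t < i \<and> i \<le> size P \<longrightarrow> row_length 1 2 P i < t + \<nu> + 2)" for t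
  proof -
    have "row_length 1 2 P i < t + \<nu> + 2 \<longleftrightarrow> nth_part P i < 2 * t + (2 * \<nu> + 3)" if "t < i" "i \<le> size P" for i
      using row [of i "t + \<nu>"] that by (auto simp: not_le [symmetric] algebra_simps)
    moreover have "t + \<nu> + 2 \<le> row_length 1 2 P t \<longleftrightarrow> 2 * t + (2 * \<nu> + 3) \<le> nth_part P t" if "0 < t" "t \<le> size P"
      using row [of t "t + \<nu>"] that by (auto simp: algebra_simps)
    ultimately show ?thesis unfolding cnt size_filter_eq_iff_sorted_desc by auto
  qed
  have hD: "?h \<in> ?D" unfolding durfee_height_def using fin by (intro Max_in) auto
  have h_eq: "?h = t" if t: "t \<in> ?D" "\<forall>i. t < i \<and> i \<le> size P \<longrightarrow> row_length 1 2 P i < t + \<nu> + 2" for t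
    unfolding durfee_height_def
  proof (rule Max_eqI [OF fin _ t(1)])
    fix u assume "u \<in> ?D"
    then show "u \<le> t" using t(2) [rule_format, of u] by (cases "u \<le> t") auto
  qed
  show ?thesis
    unfolding durfee_balanced_def bal
  proof
    assume "\<forall>i. ?h < i \<and> i \<le> size P \<longrightarrow> row_length 1 2 P i < ?h + \<nu> + 2"
    with hD show "\<exists>t. t \<in> ?D \<and> (\<forall>i. t < i \<and> i \<le> size P \<longrightarrow> row_length 1 2 P i < t + \<nu> + 2)"
      by (intro exI conjI)
  next
    assume "\<exists>t. t \<in> ?D \<and> (\<forall>i. t < i \<and> i \<le> size P \<longrightarrow> row_length 1 2 P i < t + \<nu> + 2)"
    then obtain t where t: "t \<in> ?D" "\<forall>i. t < i \<and> i \<le> size P \<longrightarrow> row_length 1 2 P i < t + \<nu> + 2"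
      by (elim exE conjE)
    show "\<forall>i. ?h < i \<and> i \<le> size P \<longrightarrow> row_length 1 2 P i < ?h + \<nu> + 2"
      unfolding h_eq [OF t] by (rule t(2))
  qed
qed

text \<open>Balance depends on the odd parts only, and the prescribed parts 1 + 2 j are odd, so both
  conditions can be read off from \<open>R\<close> without filtering.\<close>

lemma M_partitions_1_2_iff:
  assumes "\<forall>x\<in>#R. 0 < x"
  shows "filter_mset odd R \<in> M_partitions 1 2 \<nu> (\<Sum>\<^sub># (filter_mset odd R))
     \<longleftrightarrow> (\<forall>j\<le>\<nu>. 1 + 2 * j \<in># R) \<and> durfee_balanced (2 * \<nu> + 3) R"
proof -
  have "durfee_balanced k (filter_mset odd R) = durfee_balanced k R" for k
    unfolding durfee_balanced_def odd_count_def by (simp add: filter_filter_mset conj_commute)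
  moreover have "\<forall>x\<in>#filter_mset odd R. [x = 1] (mod 2)"
    by (simp add: cong_def odd_iff_mod_2_eq_one)
  ultimately show ?thesis
    unfolding M_partitions_def partitions_def
    using durfee_height_rows_iff [of "filter_mset odd R" \<nu>] assms by auto
qed

section \<open>Removing the parts 1, 3, ..., 2 \<nu> + 1\<close>

definition odd_staircase :: "nat \<Rightarrow> nat multiset" where
  "odd_staircase \<nu> = mset_set ((\<lambda>j. 1 + 2 * j) ` {..\<nu>})"

lemma sum_mset_odd_staircase: "\<Sum>\<^sub># (odd_staircase \<nu>) = (\<nu> + 1)\<^sup>2"
proof -
  have "\<Sum>\<^sub># (odd_staircase \<nu>) = (\<Sum>j\<le>\<nu>. 1 + 2 * j)"
    unfolding odd_staircase_def sum_mset_mset_set by (subst sum.reindex) (auto simp: inj_on_def)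
  also have "\<dots> = (\<nu> + 1)\<^sup>2"
    by (induction \<nu>) (auto simp: power2_eq_square algebra_simps)
  finally show ?thesis .
qed

lemma odd_staircase_subseteq_iff: "odd_staircase \<nu> \<subseteq># R \<longleftrightarrow> (\<forall>j\<le>\<nu>. 1 + 2 * j \<in># R)"
  unfolding odd_staircase_def by (subst mset_set_subseteq_iff) auto

text \<open>The largest staircase part, 2 \<nu> + 1, lies below every threshold 2 t + 2 \<nu> +
  3.\<close>

lemma durfee_balanced_add_odd_staircase:
  "durfee_balanced (2 * \<nu> + 3) (R + odd_staircase \<nu>) = durfee_balanced (2 * \<nu> + 3) R"
proof -
  have "{#x \<in># odd_staircase \<nu>. odd x \<and> 2 * t + (2 * \<nu> + 3) \<le> x#} = {#}" for t
    by (simp only: filter_mset_eq_mempty_iff) (auto simp: odd_staircase_def)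
  then show ?thesis
    by (simp add: durfee_balanced_def odd_count_def del: filter_mset_eq_mempty_iff)
qed

text \<open>Two bijections are composed: splitting off the overlined parts turns the defining
  condition into one on \<open>R\<close>, and then the staircase is subtracted from
  \<open>R\<close>.\<close>

lemma overp_1_2_eq_card_balanced_overpairs:
  assumes "(\<nu> + 1)\<^sup>2 \<le> n"
  shows "overp_1_2 \<nu> n = card (balanced_overpairs (2 * \<nu> + 3) (n - (\<nu> + 1)\<^sup>2))"
proof -
  let ?A = "{\<pi> \<in> overpartitions n. nonoverlined_odd_parts \<pi>
         \<in> M_partitions 1 2 \<nu> (n - \<Sum>\<^sub># (fst \<pi> - nonoverlined_odd_parts \<pi>))}"
  let ?B = "{(R, S) \<in> overpairs {0<..} {0<..} n. odd_staircase \<nu> \<subseteq># R \<and> durfee_balanced (2 * \<nu> + 3) R}"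
  let ?f = "\<lambda>(P, S). (P - mset_set S, S :: nat set)"
  have iff: "\<pi> \<in> ?A \<longleftrightarrow> ?f \<pi> \<in> ?B" if \<pi>: "\<pi> \<in> overpartitions n" for \<pi>
  proof -
    obtain P S where PS: "\<pi> = (P, S)" by fastforce
    define R where "R = P - mset_set S"
    have R: "(R, S) \<in> overpairs {0<..} {0<..} n"
      using bij_betwE [OF bij_betw_overpartitions] \<pi> PS by (fastforce simp: R_def)
    have noo: "nonoverlined_odd_parts \<pi> = filter_mset odd R"
      by (simp add: nonoverlined_odd_parts_def PS R_def)
    have sub: "filter_mset odd R \<subseteq># P"
      unfolding R_def by (meson diff_subset_eq_self multiset_filter_subset subset_mset.order_trans)
    have "\<Sum>\<^sub># (P - filter_mset odd R) + \<Sum>\<^sub># (filter_mset odd R) = \<Sum>\<^sub># P"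
      by (metis sub subset_mset.diff_add sum_mset.union)
    moreover have "\<Sum>\<^sub># P = n" using \<pi> PS by (simp add: overpartitions_def partitions_def)
    \<comment> \<open>The argument n - \<alpha> of \<open>M_partitions\<close> is thus the sum of
      the non-overlined odd parts, as \<open>M_partitions_1_2_iff\<close> requires.\<close>
    ultimately have "n - \<Sum>\<^sub># (P - filter_mset odd R) = \<Sum>\<^sub># (filter_mset odd R)" by simp
    moreover have "\<forall>x\<in>#R. 0 < x" using R by (auto simp: overpairs_def)
    ultimately show ?thesis
      using \<pi> PS R M_partitions_1_2_iff [of R \<nu>] noo
      by (simp add: odd_staircase_subseteq_iff flip: R_def)
  qed
  have "bij_betw ?f ?A ?B"
  proof (rule bij_betw_subset [OF bij_betw_overpartitions])
    show "?A \<subseteq> overpartitions n" by (rule Collect_restrict)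
    show "?f ` ?A = ?B"
    proof (intro equalityI subsetI)
      fix p assume "p \<in> ?f ` ?A"
      then obtain \<pi> where \<pi>: "\<pi> \<in> ?A" "p = ?f \<pi>" by (rule imageE)
      then have "\<pi> \<in> overpartitions n" by simp
      from iff [OF this] \<pi> show "p \<in> ?B" by argo
    next
      fix p assume p: "p \<in> ?B"
      then have "p \<in> overpairs {0<..} {0<..} n" by auto
      then have "p \<in> ?f ` overpartitions n"
        by (simp only: bij_betw_imp_surj_on [OF bij_betw_overpartitions])
      then obtain \<pi> where \<pi>: "p = ?f \<pi>" "\<pi> \<in> overpartitions n" by (rule imageE)
      from iff [OF \<pi>(2)] p have "\<pi> \<in> ?A" unfolding \<pi>(1) by argo
      then show "p \<in> ?f ` ?A" unfolding \<pi>(1) by (rule imageI)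
    qed
  qed
  then have "overp_1_2 \<nu> n = card ?B"
    unfolding overp_1_2_def by (rule bij_betw_same_card)
  also have "bij_betw (\<lambda>(R, S). (R - odd_staircase \<nu>, S)) ?B (balanced_overpairs (2 * \<nu> + 3) (n - (\<nu> + 1)\<^sup>2))"
  proof (rule bij_betw_byWitness [where f' = "\<lambda>(R, S). (R + odd_staircase \<nu>, S)"])
    have "(R - odd_staircase \<nu>, S) \<in> balanced_overpairs (2 * \<nu> + 3) (n - (\<nu> + 1)\<^sup>2)"
      if RS: "(R, S) \<in> ?B" for R S
    proof -
      obtain Q where Q: "R = Q + odd_staircase \<nu>"
        using RS by (metis (no_types, lifting) CollectD case_prodD subset_mset.diff_add)
      have "\<Sum>\<^sub># Q + (\<nu> + 1)\<^sup>2 + \<Sum>S = n"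
        using RS Q sum_mset_odd_staircase [of \<nu>] by (simp add: overpairs_def)
      then show ?thesis
        using RS Q durfee_balanced_add_odd_staircase [of \<nu> Q]
        by (auto simp: overpairs_def balanced_overpairs_def)
    qed
    then show "(\<lambda>(R, S). (R - odd_staircase \<nu>, S)) ` ?B \<subseteq> balanced_overpairs (2 * \<nu> + 3) (n - (\<nu> + 1)\<^sup>2)"
      by fast
    have "\<forall>x\<in>#odd_staircase \<nu>. 0 < x" by (auto simp: odd_staircase_def)
    then show "(\<lambda>(R, S). (R + odd_staircase \<nu>, S)) ` balanced_overpairs (2 * \<nu> + 3) (n - (\<nu> + 1)\<^sup>2) \<subseteq> ?B"
      using assms sum_mset_odd_staircase [of \<nu>] durfee_balanced_add_odd_staircase [of \<nu>]
      by (auto simp: overpairs_def balanced_overpairs_def)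
  qed auto
  then have "card ?B = card (balanced_overpairs (2 * \<nu> + 3) (n - (\<nu> + 1)\<^sup>2))"
    by (rule bij_betw_same_card)
  finally show ?thesis .
qed

text \<open>Descending induction on \<open>\<nu>\<close>, phrased as complete induction on
  \<open>n - \<nu>\<close>: both sides satisfy the same recurrence linking \<open>\<nu>\<close> and
  \<open>\<nu> + 1\<close>.\<close>

lemma truncated_gauss_overpartitions:
  assumes "(\<nu> + 1)\<^sup>2 \<le> n"
  shows "(-1) ^ \<nu> * (int (overp n) + 2 * (\<Sum>\<tau>=1..\<nu>. (-1) ^ \<tau> * int (overp (n - \<tau>\<^sup>2))))
         = 2 * int (card (balanced_overpairs (2 * \<nu> + 3) (n - (\<nu> + 1)\<^sup>2)))"
  using assms
proof (induction "n - \<nu>" arbitrary: \<nu> rule: less_induct)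
  case less
  define T where "T \<nu> = int (overp n) + 2 * (\<Sum>\<tau>=1..\<nu>. (-1) ^ \<tau> * int (overp (n - \<tau>\<^sup>2)))" for \<nu>
  have T_Suc: "T (Suc \<nu>) = T \<nu> - 2 * (-1) ^ \<nu> * int (overp (n - (\<nu> + 1)\<^sup>2))"
    by (simp add: T_def)
  have sq: "(-1) ^ \<nu> * (-1) ^ \<nu> = (1 :: int)" by (simp flip: power_mult_distrib)
  \<comment> \<open>The gap between consecutive squares is exactly the shift
    \<open>k = 2 * \<nu> + 3\<close> of the recurrence.\<close>
  have sqr: "(Suc \<nu> + 1)\<^sup>2 = (\<nu> + 1)\<^sup>2 + (2 * \<nu> + 3)" by (simp add: power2_eq_square)
  have rec: "card (balanced_overpairs (2 * \<nu> + 3) (n - (\<nu> + 1)\<^sup>2))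
      + (if (Suc \<nu> + 1)\<^sup>2 \<le> n then card (balanced_overpairs (2 * Suc \<nu> + 3) (n - (Suc \<nu> + 1)\<^sup>2)) else 0)
      = overp (n - (\<nu> + 1)\<^sup>2)"
    using balanced_overpairs_recurrence [of "2 * \<nu> + 3" "n - (\<nu> + 1)\<^sup>2"] less.prems
    unfolding sqr by (auto simp: le_diff_conv2 add_ac)
  have step: "(-1) ^ \<nu> * T \<nu> = 2 * int (overp (n - (\<nu> + 1)\<^sup>2)) - (-1) ^ Suc \<nu> * T (Suc \<nu>)"
  proof -
    have "(-1) ^ Suc \<nu> * T (Suc \<nu>) = 2 * ((-1) ^ \<nu> * (-1) ^ \<nu>) * int (overp (n - (\<nu> + 1)\<^sup>2)) - (-1) ^ \<nu> * T \<nu>"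
      unfolding T_Suc by (simp add: algebra_simps)
    then show ?thesis unfolding sq by simp
  qed
  have "(-1) ^ \<nu> * T \<nu> = 2 * int (card (balanced_overpairs (2 * \<nu> + 3) (n - (\<nu> + 1)\<^sup>2)))"
  proof (cases "(Suc \<nu> + 1)\<^sup>2 \<le> n")
    case True
    have "\<nu> < (\<nu> + 1)\<^sup>2" by (simp add: power2_eq_square)
    then have "n - Suc \<nu> < n - \<nu>" using less.prems by linarith
    from less.hyps [OF this True] show ?thesis
      using step rec True unfolding T_def [symmetric] by simp
  next
    case False
    \<comment> \<open>Here (\<nu> + 1)^2 \<le> n < (\<nu> + 2)^2, so \<open>T (Suc \<nu>)\<close> is
      the complete Gauss sum and vanishes.\<close>
    have "{\<tau>. 1 \<le> \<tau> \<and> \<tau>\<^sup>2 \<le> n} = {1..Suc \<nu>}"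
    proof -
      have "\<tau> \<le> Suc \<nu>" if "\<tau>\<^sup>2 \<le> n" for \<tau>
      proof (rule ccontr)
        assume "\<not> \<tau> \<le> Suc \<nu>"
        then have "(Suc \<nu> + 1)\<^sup>2 \<le> \<tau>\<^sup>2" by (intro power_mono) auto
        then show False using that False by linarith
      qed
      moreover have "\<tau>\<^sup>2 \<le> n" if "\<tau> \<le> Suc \<nu>" for \<tau>
        using order_trans [OF power_mono [of \<tau> "\<nu> + 1" 2] less.prems] that by simp
      ultimately show ?thesis by auto
    qed
    moreover have "n > 0" using less.prems less_le_trans [of 0 "(\<nu> + 1)\<^sup>2" n] by simp
    ultimately have "T (Suc \<nu>) = 0" using gauss_overpartitions [of n] by (simp add: T_def)
    then show ?thesis using step rec False by simp
  qed
  then show ?case by (simp add: T_def)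
qed

theorem theorem1p7:
  fixes \<nu> n :: nat
  assumes "\<nu> \<ge> 1" and "n \<ge> (\<nu> + 1)\<^sup>2"
  shows "(-1) ^ \<nu> * (int (overp n) + 2 * (\<Sum>\<tau>=1..\<nu>. (-1) ^ \<tau> * int (overp (n - \<tau>\<^sup>2))))
         = 2 * int (overp_1_2 \<nu> n)"
  unfolding overp_1_2_eq_card_balanced_overpairs [OF assms(2)]
  by (rule truncated_gauss_overpartitions [OF assms(2)])

end
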